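(* For any integers $r>r'\ge1$ we have $G(r')\subset N(r')\subset G(r)$ as subgroups of $W$.
   Context: Tree: $T$ is the regular rooted binary tree whose vertices are the finite words over $\{0,1\}$ (root = empty word; the children of $t$ are $t0,t1$). $W=\mathrm{Aut}(T)$ is the profinite group of automorphisms of $T$ fixing the root. Identifying the subtrees below the vertices $0$ and $1$ with $T$ gives $W=(W\times W)\rtimes\langle\sigma\rangle$, where $(u,v)$ acts by $u$ on the first and by $v$ on the second subtree, and $\sigma$ is the involution interchanging the two subtrees, so $\sigma(u,v)=(v,u)\sigma$. The groups $G(r)$ and $N(r)$: for an integer $r\ge1$, define elements $a_i$ ($i\ge1$) and $b_j$ ($1\le j\le r$) of $W$ (depending on $r$) as the unique elements satisfying the recursion relations $a_1=\sigma$; $a_{r+1}=(a_r,b_r)$; $a_i=(a_{i-1},1)$ for all $i>1$ with $i\ne r+1$; $b_1=(b_r,b_r^{-1})\sigma$; $b_j=(b_rb_{j-1}b_r^{-1},1)$ for all $1<j\le r$. (Such relations determine unique elements of $W$, level by level.) $G(r)$ is the closure in $W$ of the subgroup generated by all $a_i$ and $b_j$. $N(r)=\mathrm{Norm}_W(G(r))$ is the normalizer of $G(r)$ in $W$. *)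

theory Defs
  imports "HOL-Analysis.Abstract_Topology" "HOL-Analysis.Function_Topology" "HOL-Algebra.Algebra"
begin

text \<open>
  Vertices are finite words \<^typ>\<open>bool list\<close>, with \<^const>\<open>False\<close> for the letter 0 and \<^const>\<open>True\<close>
  for the letter 1. The root is \<^term>\<open>[]\<close> and the children of \<^term>\<open>t\<close> are \<^term>\<open>t @ [x]\<close>.
\<close>

definition tree_adj :: "bool list \<Rightarrow> bool list \<Rightarrow> bool" where
  "tree_adj t u \<longleftrightarrow> (\<exists>x. u = t @ [x]) \<or> (\<exists>x. t = u @ [x])"

definition tree_aut :: "(bool list \<Rightarrow> bool list) set" where
  "tree_aut = {f. bij f \<and> f [] = [] \<and> (\<forall>t u. tree_adj (f t) (f u) \<longleftrightarrow> tree_adj t u)}"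

text \<open>Automorphisms act from the left, so a product applies its right factor first.\<close>

definition AutT :: "(bool list \<Rightarrow> bool list) monoid" where
  "AutT = \<lparr>carrier = tree_aut, monoid.mult = (\<circ>), one = id\<rparr>"

text \<open>
  The profinite topology on \<^const>\<open>AutT\<close> is the topology of pointwise convergence: a neighbourhood
  base of \<^term>\<open>f\<close> is given by the automorphisms that agree with \<^term>\<open>f\<close> on all words up to
  a given length.
\<close>

definition AutT_topology :: "(bool list \<Rightarrow> bool list) topology" where
  "AutT_topology =
     subtopology (product_topology (\<lambda>_. discrete_topology UNIV) UNIV) (carrier AutT)"

fun tree_pair :: "(bool list \<Rightarrow> bool list) \<Rightarrow> (bool list \<Rightarrow> bool list) \<Rightarrow> bool list \<Rightarrow> bool list" where
  "tree_pair u v [] = []"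
| "tree_pair u v (False # w) = False # u w"
| "tree_pair u v (True # w) = True # v w"

fun tree_swap :: "bool list \<Rightarrow> bool list" where
  "tree_swap [] = []"
| "tree_swap (x # w) = (\<not> x) # w"

definition recursion_relations ::
    "nat \<Rightarrow> (nat \<Rightarrow> bool list \<Rightarrow> bool list) \<Rightarrow> (nat \<Rightarrow> bool list \<Rightarrow> bool list) \<Rightarrow> bool" where
  "recursion_relations r a b \<longleftrightarrow>
     a 1 = tree_swap \<and>
     a (r + 1) = tree_pair (a r) (b r) \<and>
     (\<forall>i>1. i \<noteq> r + 1 \<longrightarrow> a i = tree_pair (a (i - 1)) \<one>\<^bsub>AutT\<^esub>) \<and>
     b 1 = tree_pair (b r) (inv\<^bsub>AutT\<^esub> (b r)) \<otimes>\<^bsub>AutT\<^esub> tree_swap \<and>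
     (\<forall>j. 1 < j \<and> j \<le> r \<longrightarrow>
        b j = tree_pair (b r \<otimes>\<^bsub>AutT\<^esub> b (j - 1) \<otimes>\<^bsub>AutT\<^esub> inv\<^bsub>AutT\<^esub> (b r)) \<one>\<^bsub>AutT\<^esub>)"

text \<open>
  Extensional function spaces fix the irrelevant values \<^term>\<open>a 0\<close> and \<^term>\<open>b j\<close> for
  \<^term>\<open>j \<notin> {1..r}\<close>, so that the pair of families is unique (lemma \<open>ex1_gens\<close> below).
\<close>

definition gens :: "nat \<Rightarrow> (nat \<Rightarrow> bool list \<Rightarrow> bool list) \<times> (nat \<Rightarrow> bool list \<Rightarrow> bool list)" where
  "gens r = (THE (a, b). a \<in> {1..} \<rightarrow>\<^sub>E carrier AutT \<and> b \<in> {1..r} \<rightarrow>\<^sub>E carrier AutT \<and>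
                         recursion_relations r a b)"

definition gen_a :: "nat \<Rightarrow> nat \<Rightarrow> bool list \<Rightarrow> bool list" where
  "gen_a r = fst (gens r)"

definition gen_b :: "nat \<Rightarrow> nat \<Rightarrow> bool list \<Rightarrow> bool list" where
  "gen_b r = snd (gens r)"

definition grp_G :: "nat \<Rightarrow> (bool list \<Rightarrow> bool list) set" where
  "grp_G r = AutT_topology closure_of generate AutT (gen_a r ` {1..} \<union> gen_b r ` {1..r})"

definition grp_N :: "nat \<Rightarrow> (bool list \<Rightarrow> bool list) set" where
  "grp_N r = normalizer AutT (grp_G r)"


subsection \<open>The automorphism group\<close>

lemma AutT_simps [simp]:
  "carrier AutT = tree_aut" "f \<otimes>\<^bsub>AutT\<^esub> g = f \<circ> g" "\<one>\<^bsub>AutT\<^esub> = id"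
  by (simp_all add: AutT_def)

lemma tree_aut_id: "id \<in> tree_aut"
  by (simp add: tree_aut_def)

lemma tree_aut_comp: "f \<in> tree_aut \<Longrightarrow> g \<in> tree_aut \<Longrightarrow> f \<circ> g \<in> tree_aut"
  by (auto simp: tree_aut_def intro: bij_comp)

lemma tree_aut_bij: "f \<in> tree_aut \<Longrightarrow> bij f"
  by (simp add: tree_aut_def)

lemma tree_aut_inv:
  assumes "f \<in> tree_aut" shows "Hilbert_Choice.inv f \<in> tree_aut"
proof -
  have f: "bij f" "f [] = []" "\<And>t u. tree_adj (f t) (f u) \<longleftrightarrow> tree_adj t u"
    using assms by (auto simp: tree_aut_def)
  have "tree_adj (Hilbert_Choice.inv f t) (Hilbert_Choice.inv f u) \<longleftrightarrow> tree_adj t u" for t u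
    using f(3)[of "Hilbert_Choice.inv f t" "Hilbert_Choice.inv f u"] f(1)
    by (simp add: bij_is_surj surj_f_inv_f)
  moreover have "Hilbert_Choice.inv f [] = []"
    using f(1,2) by (metis bij_inv_eq_iff)
  ultimately show ?thesis
    using f(1) by (simp add: tree_aut_def bij_imp_bij_inv)
qed

lemma group_AutT: "Group.group AutT"
proof (rule groupI)
  fix f assume "f \<in> carrier AutT"
  then show "\<exists>g\<in>carrier AutT. g \<otimes>\<^bsub>AutT\<^esub> f = \<one>\<^bsub>AutT\<^esub>"
    by (intro bexI[of _ "Hilbert_Choice.inv f"])
       (simp_all add: tree_aut_inv inv_o_cancel bij_is_inj tree_aut_bij)
qed (auto simp: tree_aut_id tree_aut_comp comp_assoc)

lemma AutT_inv_eq: "f \<in> tree_aut \<Longrightarrow> inv\<^bsub>AutT\<^esub> f = Hilbert_Choice.inv f"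
  by (rule group.inv_equality[OF group_AutT])
     (simp_all add: tree_aut_inv inv_o_cancel bij_is_inj tree_aut_bij)

lemma tree_aut_snoc:
  assumes "f \<in> tree_aut"
  shows "length (f t) = length t \<and> (\<exists>y. f (t @ [x]) = f t @ [y])"
proof (induction t arbitrary: x rule: rev_induct)
  case Nil
  have "tree_adj [] [x]" by (simp add: tree_adj_def)
  moreover have "f [] = []" "\<And>t u. tree_adj (f t) (f u) \<longleftrightarrow> tree_adj t u"
    using assms by (simp_all add: tree_aut_def)
  ultimately have "tree_adj (f []) (f [x])" and "f [] = []" by blast+
  then show ?case by (auto simp: tree_adj_def)
next
  case (snoc z t)
  from snoc[of z] obtain y where y: "f (t @ [z]) = f t @ [y]" and len: "length (f t) = length t"
    by auto
  have "tree_adj (f (t @ [z])) (f ((t @ [z]) @ [x]))"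
    using assms by (force simp: tree_aut_def tree_adj_def)
  moreover have "f (t @ [z]) \<noteq> f ((t @ [z]) @ [x]) @ [w]" for w
  proof
    assume "f (t @ [z]) = f ((t @ [z]) @ [x]) @ [w]"
    with y have "f ((t @ [z]) @ [x]) = f t" by simp
    then have "(t @ [z]) @ [x] = t"
      using tree_aut_bij[OF assms] by (auto simp: bij_def inj_def)
    then show False by simp
  qed
  ultimately show ?case using y len by (auto simp: tree_adj_def)
qed

lemma tree_aut_length: "f \<in> tree_aut \<Longrightarrow> length (f t) = length t"
  using tree_aut_snoc by blast

lemma tree_aut_iff:
  "f \<in> tree_aut \<longleftrightarrow> bij f \<and> (\<forall>t. length (f t) = length t) \<and> (\<forall>t x. \<exists>y. f (t @ [x]) = f t @ [y])"
    (is "_ \<longleftrightarrow> ?R")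
proof
  assume "f \<in> tree_aut"
  then show ?R using tree_aut_bij tree_aut_snoc by blast
next
  assume R: ?R
  have step: "(\<exists>y. f u = f t @ [y]) \<longleftrightarrow> (\<exists>x. u = t @ [x])" for t u
  proof
    assume "\<exists>y. f u = f t @ [y]"
    then obtain y where y: "f u = f t @ [y]" by blast
    then have "length (f u) = Suc (length (f t))" by simp
    with R have "length u = Suc (length t)" by simp
    then obtain t' x where u: "u = t' @ [x]" and "length t' = length t"
      by (metis length_Suc_conv_rev)
    from R u obtain y' where "f u = f t' @ [y']" by blast
    with y have "f t' = f t" by simp
    with R have "t' = t" by (auto simp: bij_def inj_def)
    with u show "\<exists>x. u = t @ [x]" by blast
  qed (use R in blast)
  have "f [] = []" using R by (metis length_0_conv)
  then show "f \<in> tree_aut" using R step by (simp add: tree_aut_def tree_adj_def)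
qed

lemma tree_aut_swap: "tree_swap \<in> tree_aut"
proof -
  have "tree_swap (tree_swap w) = w" for w by (cases w) auto
  then have "bij tree_swap" by (intro o_bij[of tree_swap]) auto
  moreover have "length (tree_swap w) = length w" for w by (cases w) auto
  moreover have "\<exists>y. tree_swap (w @ [x]) = tree_swap w @ [y]" for w x by (cases w) auto
  ultimately show ?thesis by (auto simp: tree_aut_iff)
qed

lemma tree_pair_comp: "tree_pair u v \<circ> tree_pair u' v' = tree_pair (u \<circ> u') (v \<circ> v')"
proof
  fix w show "(tree_pair u v \<circ> tree_pair u' v') w = tree_pair (u \<circ> u') (v \<circ> v') w"
    by (cases "(u', v', w)" rule: tree_pair.cases) auto
qed

lemma tree_pair_id: "tree_pair id id = id"
proof
  fix w show "tree_pair id id w = id w"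
    by (cases "(id :: bool list \<Rightarrow> bool list, id :: bool list \<Rightarrow> bool list, w)" rule: tree_pair.cases) auto
qed

lemma tree_aut_pair:
  assumes "u \<in> tree_aut" "v \<in> tree_aut" shows "tree_pair u v \<in> tree_aut"
proof -
  let ?u = "Hilbert_Choice.inv u" and ?v = "Hilbert_Choice.inv v"
  have "bij u" "bij v" using assms by (auto dest: tree_aut_bij)
  then have "?u \<circ> u = id" "u \<circ> ?u = id" "?v \<circ> v = id" "v \<circ> ?v = id"
    by (simp_all add: inv_o_cancel bij_is_inj surj_iff[THEN iffD1] bij_is_surj)
  then have "bij (tree_pair u v)"
    by (intro o_bij[of "tree_pair ?u ?v"]) (simp_all add: tree_pair_comp tree_pair_id)
  moreover have "length (tree_pair u v w) = length w" for w
    by (cases "(u, v, w)" rule: tree_pair.cases) (use assms in \<open>auto simp: tree_aut_length\<close>)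
  moreover have "\<exists>y. tree_pair u v (w @ [x]) = tree_pair u v w @ [y]" for w x
  proof (cases w)
    case Nil
    then show ?thesis using assms by (cases x) (auto simp: tree_aut_def)
  next
    case (Cons z w')
    then show ?thesis using tree_aut_snoc[OF assms(1), of w' x] tree_aut_snoc[OF assms(2), of w' x]
      by (cases z) auto
  qed
  ultimately show ?thesis by (auto simp: tree_aut_iff)
qed

lemma tree_aut_fix_letter:
  assumes g: "g \<in> tree_aut" and gF: "g [False] = [False]"
  shows "g [x] = [x]"
proof -
  have inj: "inj g" using tree_aut_bij[OF g] by (simp add: bij_def)
  have "length (g [True]) = 1" using tree_aut_length[OF g] by simp
  then obtain y where y: "g [True] = [y]" by (auto simp: length_Suc_conv)
  have "g [True] \<noteq> g [False]" using inj_eq[OF inj] by simp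
  with gF y have "y = True" by simp
  with gF y show ?thesis by (cases x) simp_all
qed

lemma tree_aut_hd:
  assumes g: "g \<in> tree_aut" and gF: "g [False] = [False]"
  shows "\<exists>v. g (x # w) = x # v"
proof (induction w rule: rev_induct)
  case Nil
  show ?case using tree_aut_fix_letter[OF assms] by simp
next
  case (snoc y w)
  obtain z where "g ((x # w) @ [y]) = g (x # w) @ [z]" using tree_aut_snoc[OF g] by blast
  with snoc show ?case by auto
qed

lemma tree_aut_section:
  assumes g: "g \<in> tree_aut" and s: "\<And>w. g (x # w) = x # s w"
  shows "s \<in> tree_aut"
proof -
  have inj: "inj g" using tree_aut_bij[OF g] by (simp add: bij_def)
  have "inj s"
  proof (rule injI)
    fix v w assume "s v = s w"
    then have "g (x # v) = g (x # w)" by (simp add: s)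
    then have "x # v = x # w" by (rule injD[OF inj])
    then show "v = w" by simp
  qed
  moreover have len: "length (s w) = length w" for w
    using tree_aut_length[OF g, of "x # w"] by (simp add: s)
  moreover have "\<exists>z. s (w @ [y]) = s w @ [z]" for w y
    using tree_aut_snoc[OF g, of "x # w" y] by (simp add: s)
  moreover have "surj s"
  proof -
    have "s ` {w. length w = n} = {w. length w = n}" for n
    proof (rule card_subset_eq)
      show fin: "finite {w :: bool list. length w = n}"
        using finite_lists_length_eq[of "UNIV :: bool set" n] by simp
      show "s ` {w. length w = n} \<subseteq> {w. length w = n}" using len by auto
      show "card (s ` {w. length w = n}) = card {w :: bool list. length w = n}"
        using \<open>inj s\<close> by (intro card_image) (simp add: inj_on_def)
    qed
    then have "w \<in> range s" for w by blast
    then show ?thesis by blast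
  qed
  ultimately show ?thesis by (simp add: tree_aut_iff bij_def)
qed

lemma tree_aut_decompose_fix:
  assumes g: "g \<in> tree_aut" and gF: "g [False] = [False]"
  shows "\<exists>u\<in>tree_aut. \<exists>v\<in>tree_aut. g = tree_pair u v"
proof -
  define u where "u = (\<lambda>w. tl (g (False # w)))"
  have u: "g (False # w) = False # u w" for w
    using tree_aut_hd[OF assms, of False w] by (auto simp: u_def)
  define v where "v = (\<lambda>w. tl (g (True # w)))"
  have v: "g (True # w) = True # v w" for w
    using tree_aut_hd[OF assms, of True w] by (auto simp: v_def)
  have "g w = tree_pair u v w" for w
  proof (cases w)
    case Nil
    then show ?thesis using g by (simp add: tree_aut_def)
  next
    case (Cons x w')
    then show ?thesis using u v by (cases x) simp_all
  qed
  then have "g = tree_pair u v" by (rule ext)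
  moreover have "u \<in> tree_aut" "v \<in> tree_aut"
    by (rule tree_aut_section[OF g], rule u) (rule tree_aut_section[OF g], rule v)
  ultimately show ?thesis by (intro bexI)
qed

lemma tree_aut_decompose:
  assumes "f \<in> tree_aut"
  shows "\<exists>u\<in>tree_aut. \<exists>v\<in>tree_aut. f = tree_pair u v \<or> f = tree_pair u v \<circ> tree_swap"
proof (cases "f [False] = [False]")
  case True
  then show ?thesis using tree_aut_decompose_fix[OF assms] by metis
next
  case False
  have "tree_swap (tree_swap w) = w" for w by (cases w) simp_all
  then have swap2: "tree_swap \<circ> tree_swap = id" by (simp add: fun_eq_iff)
  obtain z where z: "f z = [False]" using tree_aut_bij[OF assms] by (metis bij_pointE)
  then have "length z = 1" using tree_aut_length[OF assms, of z] by simp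
  then obtain x where x: "z = [x]" by (auto simp: length_Suc_conv)
  have "x" using z x False by (cases x) simp_all
  with z x have "(f \<circ> tree_swap) [False] = [False]" by simp
  then obtain u v where uv: "u \<in> tree_aut" "v \<in> tree_aut" "f \<circ> tree_swap = tree_pair u v"
    using tree_aut_decompose_fix[OF tree_aut_comp[OF assms tree_aut_swap]] by blast
  have "f = (f \<circ> tree_swap) \<circ> tree_swap"
    by (simp only: comp_assoc swap2 comp_id)
  also have "\<dots> = tree_pair u v \<circ> tree_swap"
    by (simp only: uv(3))
  finally show ?thesis using uv(1,2) by blast
qed


subsection \<open>Existence and uniqueness of the generators\<close>

definition agree :: "nat \<Rightarrow> (bool list \<Rightarrow> bool list) \<Rightarrow> (bool list \<Rightarrow> bool list) \<Rightarrow> bool" where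
  "agree n f g \<longleftrightarrow> (\<forall>w. length w \<le> n \<longrightarrow> f w = g w)"

lemma agree_refl [simp]: "agree n f f"
  by (simp add: agree_def)

lemma agree_sym: "agree n f g \<Longrightarrow> agree n g f"
  by (simp add: agree_def)

lemma agree_trans: "agree n f g \<Longrightarrow> agree n g h \<Longrightarrow> agree n f h"
  by (simp add: agree_def)

lemma agree_all: "(\<And>n. agree n f g) \<Longrightarrow> f = g"
  by (auto simp: agree_def)

lemma agree_0: "f \<in> tree_aut \<Longrightarrow> g \<in> tree_aut \<Longrightarrow> agree 0 f g"
  by (simp add: agree_def tree_aut_def)

lemma agree_comp:
  assumes "agree n f f'" "agree n g g'" "g \<in> tree_aut"
  shows "agree n (f \<circ> g) (f' \<circ> g')"
  using assms tree_aut_length[OF assms(3)] by (simp add: agree_def) metis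

lemma agree_inv:
  assumes "agree n f g" "f \<in> tree_aut" "g \<in> tree_aut"
  shows "agree n (inv\<^bsub>AutT\<^esub> f) (inv\<^bsub>AutT\<^esub> g)"
  unfolding agree_def
proof (intro allI impI)
  fix w :: "bool list" assume "length w \<le> n"
  let ?v = "Hilbert_Choice.inv f w"
  have "f ?v = w" using tree_aut_bij[OF assms(2)] by (simp add: bij_is_surj surj_f_inv_f)
  moreover have "length ?v \<le> n"
    using \<open>length w \<le> n\<close> tree_aut_length[OF tree_aut_inv[OF assms(2)]] by simp
  ultimately have "g ?v = w" using assms(1) by (simp add: agree_def)
  then have "Hilbert_Choice.inv g w = ?v"
    using tree_aut_bij[OF assms(3)] by (metis bij_inv_eq_iff)
  then show "(inv\<^bsub>AutT\<^esub> f) w = (inv\<^bsub>AutT\<^esub> g) w" using assms by (simp add: AutT_inv_eq)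
qed

lemma agree_pair:
  assumes "agree n u u'" "agree n v v'" shows "agree (Suc n) (tree_pair u v) (tree_pair u' v')"
  unfolding agree_def
proof (intro allI impI)
  fix w :: "bool list" assume "length w \<le> Suc n"
  then show "tree_pair u v w = tree_pair u' v' w"
    by (cases "(u, v, w)" rule: tree_pair.cases) (use assms in \<open>auto simp: agree_def\<close>)
qed

lemma tree_aut_AutT_inv: "f \<in> tree_aut \<Longrightarrow> inv\<^bsub>AutT\<^esub> f \<in> tree_aut"
  by (simp add: AutT_inv_eq tree_aut_inv)

lemma limit_tree_aut:
  assumes f: "\<And>n. f n \<in> tree_aut" and ag: "\<And>n. agree n (f n) (f (Suc n))"
  defines "L \<equiv> \<lambda>w. f (length w) w"
  shows "L \<in> tree_aut" "agree n L (f n)"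
proof -
  have mono: "agree n (f n) (f (n + k))" for n k
  proof (induction k)
    case (Suc k)
    with ag[of "n + k"] show ?case by (auto simp: agree_def)
  qed simp
  have L: "L w = f n w" if "length w \<le> n" for w n
    using mono[of "length w" "n - length w"] that by (simp add: L_def agree_def)
  then show "agree n L (f n)" by (simp add: agree_def)
  have len: "length (L w) = length w" for w
    by (simp add: L_def tree_aut_length f)
  have "inj L"
  proof (rule injI)
    fix v w assume eq: "L v = L w"
    then have "length v = length w" using len by metis
    with eq have "f (length w) v = f (length w) w" by (simp add: L_def)
    then show "v = w" using tree_aut_bij[OF f] by (auto simp: bij_def inj_def)
  qed
  moreover have "w \<in> range L" for w
  proof -
    obtain v where v: "f (length w) v = w" using tree_aut_bij[OF f] by (metis bij_pointE)
    then have "length v = length w" using tree_aut_length[OF f] by metis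
    with v have "L v = w" by (simp add: L_def)
    then show ?thesis by blast
  qed
  moreover have "\<exists>y. L (t @ [x]) = L t @ [y]" for t x
    using tree_aut_snoc[OF f[of "Suc (length t)"], of t x] L[of t "Suc (length t)"]
    by (simp add: L_def)
  ultimately show "L \<in> tree_aut" using len by (auto simp: tree_aut_iff bij_def)
qed

text \<open>
  One step of the recursion, with both families combined into one: \<^const>\<open>Inl\<close> for the
  \<open>a\<close>'s and \<^const>\<open>Inr\<close> for the \<open>b\<close>'s.
\<close>

fun rec_step :: "nat \<Rightarrow> (nat + nat \<Rightarrow> bool list \<Rightarrow> bool list) \<Rightarrow> nat + nat \<Rightarrow> bool list \<Rightarrow> bool list" where
  "rec_step r c (Inl i) =
     (if i = 1 then tree_swap else if i = r + 1 then tree_pair (c (Inl r)) (c (Inr r))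
      else tree_pair (c (Inl (i - 1))) id)"
| "rec_step r c (Inr j) =
     (if j = 1 then tree_pair (c (Inr r)) (inv\<^bsub>AutT\<^esub> (c (Inr r))) \<circ> tree_swap
      else tree_pair (c (Inr r) \<circ> c (Inr (j - 1)) \<circ> inv\<^bsub>AutT\<^esub> (c (Inr r))) id)"

lemma rec_step_tree_aut:
  assumes "\<And>k. c k \<in> tree_aut" shows "rec_step r c k \<in> tree_aut"
  by (cases k)
     (simp_all add: assms tree_aut_AutT_inv tree_aut_pair tree_aut_comp tree_aut_id tree_aut_swap)

lemma rec_step_agree:
  assumes "\<And>k. c k \<in> tree_aut" "\<And>k. c' k \<in> tree_aut" "\<And>k. agree n (c k) (c' k)"
  shows "agree (Suc n) (rec_step r c k) (rec_step r c' k)"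
  by (cases k)
     (simp_all add: assms tree_aut_AutT_inv agree_pair agree_comp agree_inv tree_aut_swap)

lemma rec_step_fixpoint: "\<exists>c. (\<forall>k. c k \<in> tree_aut) \<and> rec_step r c = c"
proof -
  define Y where "Y n = (rec_step r ^^ n) (\<lambda>_. id)" for n
  have Y: "Y n k \<in> tree_aut" for n k
    by (induction n arbitrary: k) (simp_all add: Y_def tree_aut_id rec_step_tree_aut)
  have ag: "agree n (Y n k) (Y (Suc n) k)" for n k
  proof (induction n arbitrary: k)
    case 0 show ?case by (intro agree_0 Y)
  next
    case (Suc n)
    have "agree (Suc n) (rec_step r (Y n) k) (rec_step r (Y (Suc n)) k)"
      using Suc Y by (intro rec_step_agree)
    then show ?case by (simp add: Y_def)
  qed
  define L where "L k w = Y (length w) k w" for k w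
  have L: "L k \<in> tree_aut" "agree n (L k) (Y n k)" for n k
    using limit_tree_aut[of "\<lambda>n. Y n k", OF Y ag] by (simp_all add: L_def[abs_def])
  have "agree n (rec_step r L k) (L k)" for n k
  proof (cases n)
    case 0
    then show ?thesis using L(1) rec_step_tree_aut[of L] by (simp add: agree_0)
  next
    case (Suc m)
    have "agree (Suc m) (rec_step r L k) (rec_step r (Y m) k)"
      using L Y by (intro rec_step_agree) auto
    moreover have "rec_step r (Y m) = Y (Suc m)" by (simp add: Y_def)
    ultimately show ?thesis using L(2)[of "Suc m" k] Suc by (metis agree_sym agree_trans)
  qed
  then have "rec_step r L = L" using agree_all by blast
  then show ?thesis using L(1) by blast
qed

lemma recursion_relationsD:
  assumes "recursion_relations r a b"
  shows "a 1 = tree_swap"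
    and "a (r + 1) = tree_pair (a r) (b r)"
    and "1 < i \<Longrightarrow> i \<noteq> r + 1 \<Longrightarrow> a i = tree_pair (a (i - 1)) id"
    and "b 1 = tree_pair (b r) (inv\<^bsub>AutT\<^esub> (b r)) \<circ> tree_swap"
    and "1 < j \<Longrightarrow> j \<le> r \<Longrightarrow> b j = tree_pair (b r \<circ> b (j - 1) \<circ> inv\<^bsub>AutT\<^esub> (b r)) id"
  using assms unfolding recursion_relations_def AutT_simps by blast+

lemma recursion_relations_unique:
  assumes r: "1 \<le> r"
    and ab: "a \<in> {1..} \<rightarrow> tree_aut" "b \<in> {1..r} \<rightarrow> tree_aut" "recursion_relations r a b"
    and ab': "a' \<in> {1..} \<rightarrow> tree_aut" "b' \<in> {1..r} \<rightarrow> tree_aut" "recursion_relations r a' b'"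
  shows "i \<ge> 1 \<Longrightarrow> a i = a' i" "j \<in> {1..r} \<Longrightarrow> b j = b' j"
proof -
  have mem: "\<And>i. i \<ge> 1 \<Longrightarrow> a i \<in> tree_aut" "\<And>i. i \<ge> 1 \<Longrightarrow> a' i \<in> tree_aut"
    "\<And>j. 1 \<le> j \<Longrightarrow> j \<le> r \<Longrightarrow> b j \<in> tree_aut" "\<And>j. 1 \<le> j \<Longrightarrow> j \<le> r \<Longrightarrow> b' j \<in> tree_aut"
    using ab ab' by auto
  have "(\<forall>i\<ge>1. agree n (a i) (a' i)) \<and> (\<forall>j. 1 \<le> j \<and> j \<le> r \<longrightarrow> agree n (b j) (b' j))" for n
  proof (induction n)
    case 0
    then show ?case using mem by (auto intro: agree_0)
  next
    case (Suc n)
    note memi = mem tree_aut_AutT_inv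
    have br: "b r \<in> tree_aut" "b' r \<in> tree_aut" "agree n (b r) (b' r)"
      using mem r Suc by auto
    have A: "agree (Suc n) (a i) (a' i)" if "i \<ge> 1" for i
    proof -
      have "i = 1 \<or> i = r + 1 \<or> i > 1 \<and> i \<noteq> r + 1" using that by linarith
      then consider "i = 1" | "i = r + 1" | "i > 1" "i \<noteq> r + 1" by blast
      then show ?thesis
      proof cases
        case 1
        show ?thesis
          unfolding 1 recursion_relationsD(1)[OF ab(3)] recursion_relationsD(1)[OF ab'(3)]
          by (rule agree_refl)
      next
        case 2
        show ?thesis
          unfolding 2 recursion_relationsD(2)[OF ab(3)] recursion_relationsD(2)[OF ab'(3)]
          using Suc r by (intro agree_pair) auto
      next
        case 3
        show ?thesis
          unfolding recursion_relationsD(3)[OF ab(3) 3] recursion_relationsD(3)[OF ab'(3) 3]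
          using Suc 3 by (intro agree_pair agree_refl) auto
      qed
    qed
    have B: "agree (Suc n) (b j) (b' j)" if j: "1 \<le> j" "j \<le> r" for j
    proof (cases "j = 1")
      case True
      have "agree (Suc n) (tree_pair (b r) (inv\<^bsub>AutT\<^esub> (b r)) \<circ> tree_swap)
          (tree_pair (b' r) (inv\<^bsub>AutT\<^esub> (b' r)) \<circ> tree_swap)"
        by (intro agree_comp agree_pair agree_inv agree_refl tree_aut_swap br)
      then show ?thesis
        unfolding True recursion_relationsD(4)[OF ab(3), symmetric]
          recursion_relationsD(4)[OF ab'(3), symmetric] .
    next
      case False
      with j have j1: "1 < j" by simp
      have le: "1 \<le> j - 1" "j - 1 \<le> r" using j j1 by auto
      have "agree n (b (j - 1)) (b' (j - 1))" "b (j - 1) \<in> tree_aut"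
        using Suc le mem(3)[OF le] by blast+
      then have "agree (Suc n) (tree_pair (b r \<circ> b (j - 1) \<circ> inv\<^bsub>AutT\<^esub> (b r)) id)
          (tree_pair (b' r \<circ> b' (j - 1) \<circ> inv\<^bsub>AutT\<^esub> (b' r)) id)"
        by (intro agree_comp agree_pair agree_inv agree_refl tree_aut_AutT_inv br)
      then show ?thesis
        unfolding recursion_relationsD(5)[OF ab(3) j1 j(2), symmetric]
          recursion_relationsD(5)[OF ab'(3) j1 j(2), symmetric] .
    qed
    show ?case using A B by blast
  qed
  then show "i \<ge> 1 \<Longrightarrow> a i = a' i" "j \<in> {1..r} \<Longrightarrow> b j = b' j"
    by (auto intro: agree_all)
qed

lemma ex1_gens:
  assumes "1 \<le> r"
  shows "\<exists>!(a, b). a \<in> {1..} \<rightarrow>\<^sub>E carrier AutT \<and> b \<in> {1..r} \<rightarrow>\<^sub>E carrier AutT \<and>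
                   recursion_relations r a b"
proof -
  obtain c where c: "\<And>k. c k \<in> tree_aut" and fp: "rec_step r c = c"
    using rec_step_fixpoint by blast
  have cI: "c (Inl i) = (if i = 1 then tree_swap
      else if i = r + 1 then tree_pair (c (Inl r)) (c (Inr r))
      else tree_pair (c (Inl (i - 1))) id)" for i
    using fp rec_step.simps(1) by metis
  have cJ: "c (Inr j) = (if j = 1 then tree_pair (c (Inr r)) (inv\<^bsub>AutT\<^esub> (c (Inr r))) \<circ> tree_swap
      else tree_pair (c (Inr r) \<circ> c (Inr (j - 1)) \<circ> inv\<^bsub>AutT\<^esub> (c (Inr r))) id)" for j
    using fp rec_step.simps(2) by metis
  define a where "a = restrict (\<lambda>i. c (Inl i)) {1..}"
  define b where "b = restrict (\<lambda>j. c (Inr j)) {1..r}"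
  have a_eq: "a i = c (Inl i)" if "i \<ge> 1" for i using that by (simp add: a_def)
  have b_eq: "b j = c (Inr j)" if "1 \<le> j" "j \<le> r" for j using that by (simp add: b_def)
  have mem: "a \<in> {1..} \<rightarrow>\<^sub>E carrier AutT" "b \<in> {1..r} \<rightarrow>\<^sub>E carrier AutT"
    using c by (simp_all add: a_def b_def)
  have rel: "recursion_relations r a b"
    unfolding recursion_relations_def AutT_simps
  proof (intro conjI allI impI)
    show "a 1 = tree_swap" using cI[of 1] by (simp add: a_eq)
    show "a (r + 1) = tree_pair (a r) (b r)"
      using cI[of "r + 1"] assms by (simp add: a_eq b_eq)
    show "b 1 = tree_pair (b r) (inv\<^bsub>AutT\<^esub> (b r)) \<circ> tree_swap"
      using cJ[of 1] assms by (simp add: b_eq)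
  next
    fix i :: nat assume "1 < i" "i \<noteq> r + 1"
    then show "a i = tree_pair (a (i - 1)) id" using cI[of i] by (simp add: a_eq)
  next
    fix j :: nat assume j: "1 < j \<and> j \<le> r"
    then have "b (j - 1) = c (Inr (j - 1))" by (intro b_eq) auto
    with j show "b j = tree_pair (b r \<circ> b (j - 1) \<circ> inv\<^bsub>AutT\<^esub> (b r)) id"
      using cJ[of j] by (simp add: b_eq)
  qed
  show ?thesis
  proof (rule ex1I[of _ "(a, b)"])
    show "case (a, b) of (a, b) \<Rightarrow> a \<in> {1..} \<rightarrow>\<^sub>E carrier AutT \<and> b \<in> {1..r} \<rightarrow>\<^sub>E carrier AutT \<and>
        recursion_relations r a b"
      using mem rel by simp
  next
    fix p assume "case p of (a, b) \<Rightarrow> a \<in> {1..} \<rightarrow>\<^sub>E carrier AutT \<and> b \<in> {1..r} \<rightarrow>\<^sub>E carrier AutT \<and>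
        recursion_relations r a b"
    moreover obtain a' b' where p: "p = (a', b')" by (cases p)
    ultimately have p': "a' \<in> {1..} \<rightarrow>\<^sub>E tree_aut" "b' \<in> {1..r} \<rightarrow>\<^sub>E tree_aut"
        "recursion_relations r a' b'" by auto
    have f: "a' \<in> {1..} \<rightarrow> tree_aut" "b' \<in> {1..r} \<rightarrow> tree_aut"
        "a \<in> {1..} \<rightarrow> tree_aut" "b \<in> {1..r} \<rightarrow> tree_aut"
      using p' mem by (auto simp: PiE_def)
    have "a' = a"
      using p'(1) mem(1) recursion_relations_unique(1)[OF assms f(1,2) p'(3) f(3,4) rel]
      by (intro PiE_ext[where k = "{1..}" and s = "\<lambda>_. tree_aut"]) auto
    moreover have "b' = b"
      using p'(2) mem(2) recursion_relations_unique(2)[OF assms f(1,2) p'(3) f(3,4) rel]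
      by (intro PiE_ext[where k = "{1..r}" and s = "\<lambda>_. tree_aut"]) auto
    ultimately show "p = (a, b)" using p by simp
  qed
qed

lemma gen_relations:
  assumes "1 \<le> r"
  shows "gen_a r \<in> {1..} \<rightarrow>\<^sub>E carrier AutT" "gen_b r \<in> {1..r} \<rightarrow>\<^sub>E carrier AutT"
    "recursion_relations r (gen_a r) (gen_b r)"
proof -
  have "case gens r of (a, b) \<Rightarrow> a \<in> {1..} \<rightarrow>\<^sub>E carrier AutT \<and>
          b \<in> {1..r} \<rightarrow>\<^sub>E carrier AutT \<and> recursion_relations r a b"
    unfolding gens_def by (rule theI'[OF ex1_gens[OF assms]])
  then have "gen_a r \<in> {1..} \<rightarrow>\<^sub>E carrier AutT \<and> gen_b r \<in> {1..r} \<rightarrow>\<^sub>E carrier AutT \<and>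
          recursion_relations r (gen_a r) (gen_b r)"
    unfolding gen_a_def gen_b_def case_prod_beta .
  then show "gen_a r \<in> {1..} \<rightarrow>\<^sub>E carrier AutT" "gen_b r \<in> {1..r} \<rightarrow>\<^sub>E carrier AutT"
    "recursion_relations r (gen_a r) (gen_b r)" by blast+
qed

end

theory Submission
  imports Defs
begin

text \<open>
  The idea is to show that \<open>G(r)\<close> consists of all automorphisms each of whose sections acts as an even
  permutation on level \<open>r + 1\<close>. The generators have this property and it is closed under limits. For
  the converse, \<open>u \<mapsto> (u, b\<^sub>r\<^bsup>e(u)\<^esup>)\<close>, where \<open>e(u)\<close> is the parity of \<open>u\<close> on level \<open>r\<close>,
  is a homomorphism because \<open>b\<^sub>r\<close> is an involution, and it maps the generators into the group they
  generate. Hence that group contains \<open>(u, v)\<close> as soon as \<open>u\<close>, \<open>v\<close> belong to it and have equal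
  parities on level \<open>r\<close>, and density follows by induction on the level.

  If \<open>w = (x, y)\<close> normalizes \<open>G(r')\<close>, then so do \<open>x\<close> and \<open>y\<close>, because
  \<open>(u, u) \<in> G(r')\<close> for all \<open>u \<in> G(r')\<close>. Moreover \<open>w \<sigma> w\<^sup>-\<^sup>1 = (x y\<^sup>-\<^sup>1, y x\<^sup>-\<^sup>1) \<sigma>\<close>, so
  \<open>x y\<^sup>-\<^sup>1 \<in> G(r')\<close>. Thus \<open>x\<close> and \<open>y\<close> have equal parities on all levels above \<open>r'\<close>, so \<open>w\<close> is even
  on all levels above \<open>r' + 1\<close>.
\<close>

interpretation AutT: group AutT
  by (rule group_AutT)

section \<open>Products and inverses in the wreath product decomposition\<close>

lemma tree_swap_swap: "tree_swap \<circ> tree_swap = id"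
proof
  show "(tree_swap \<circ> tree_swap) w = id w" for w by (cases w) auto
qed

lemma tree_swap_swap': "f \<circ> tree_swap \<circ> tree_swap = f"
  by (simp add: comp_assoc tree_swap_swap)

lemma tree_swap_pair: "tree_swap \<circ> tree_pair u v = tree_pair v u \<circ> tree_swap"
proof
  show "(tree_swap \<circ> tree_pair u v) w = (tree_pair v u \<circ> tree_swap) w" for w
    by (cases "(u, v, w)" rule: tree_pair.cases) auto
qed

lemma tree_pair_swap_comp:
  "tree_pair u v \<circ> (tree_pair u' v' \<circ> tree_swap) = tree_pair (u \<circ> u') (v \<circ> v') \<circ> tree_swap"
  "(tree_pair u v \<circ> tree_swap) \<circ> tree_pair u' v' = tree_pair (u \<circ> v') (v \<circ> u') \<circ> tree_swap"
  "(tree_pair u v \<circ> tree_swap) \<circ> (tree_pair u' v' \<circ> tree_swap) = tree_pair (u \<circ> v') (v \<circ> u')"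
proof -
  show 1: "tree_pair u v \<circ> (tree_pair u' v' \<circ> tree_swap) = tree_pair (u \<circ> u') (v \<circ> v') \<circ> tree_swap"
    by (simp add: comp_assoc[symmetric] tree_pair_comp)
  show 2: "(tree_pair u v \<circ> tree_swap) \<circ> tree_pair u' v' = tree_pair (u \<circ> v') (v \<circ> u') \<circ> tree_swap"
    by (simp only: comp_assoc tree_swap_pair) (simp only: comp_assoc[symmetric] tree_pair_comp)
  show "(tree_pair u v \<circ> tree_swap) \<circ> (tree_pair u' v' \<circ> tree_swap) = tree_pair (u \<circ> v') (v \<circ> u')"
    by (metis 2 comp_assoc tree_swap_swap')
qed

lemma AutT_inv_comp: "f \<in> tree_aut \<Longrightarrow> inv\<^bsub>AutT\<^esub> f \<circ> f = id" "f \<in> tree_aut \<Longrightarrow> f \<circ> inv\<^bsub>AutT\<^esub> f = id"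
  using AutT.l_inv[of f] AutT.r_inv[of f] by simp_all

lemma AutT_inv_pair:
  assumes "u \<in> tree_aut" "v \<in> tree_aut"
  shows "inv\<^bsub>AutT\<^esub> (tree_pair u v) = tree_pair (inv\<^bsub>AutT\<^esub> u) (inv\<^bsub>AutT\<^esub> v)"
    "inv\<^bsub>AutT\<^esub> (tree_pair u v \<circ> tree_swap) = tree_pair (inv\<^bsub>AutT\<^esub> v) (inv\<^bsub>AutT\<^esub> u) \<circ> tree_swap"
  using assms
  by (auto intro!: AutT.inv_equality
      simp: tree_aut_pair tree_aut_AutT_inv tree_pair_comp tree_pair_swap_comp AutT_inv_comp
        tree_pair_id tree_aut_comp tree_aut_swap)

lemma tree_aut_cases:
  assumes "f \<in> tree_aut"
  obtains (pair) u v where "u \<in> tree_aut" "v \<in> tree_aut" "f = tree_pair u v"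
  | (swap) u v where "u \<in> tree_aut" "v \<in> tree_aut" "f = tree_pair u v \<circ> tree_swap"
  using tree_aut_decompose[OF assms] by blast

lemma agree_mono: "agree n f g \<Longrightarrow> m \<le> n \<Longrightarrow> agree m f g"
  by (simp add: agree_def)

lemma agree_pairD:
  assumes "agree (Suc n) (tree_pair u v) (tree_pair u' v')" shows "agree n u u'" "agree n v v'"
proof -
  have *: "tree_pair u v (x # w) = tree_pair u' v' (x # w)" if "length w \<le> n" for x w
    using assms that by (simp add: agree_def)
  show "agree n u u'" "agree n v v'"
    using *[of _ False] *[of _ True] by (simp_all add: agree_def)
qed


subsection \<open>Parities\<close>

text \<open>
  \<^term>\<open>odd_perm n f\<close> says that \<^term>\<open>f\<close> acts as an odd permutation on the words of length \<^term>\<open>Suc n\<close>.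
\<close>

fun odd_perm :: "nat \<Rightarrow> (bool list \<Rightarrow> bool list) \<Rightarrow> bool" where
  "odd_perm 0 f = hd (f [False])"
| "odd_perm (Suc n) f \<longleftrightarrow> odd_perm n (\<lambda>w. tl (f (False # w))) \<noteq> odd_perm n (\<lambda>w. tl (f (True # w)))"

lemma odd_perm_pair [simp]:
  "odd_perm 0 (tree_pair u v) = False"
  "odd_perm 0 (tree_pair u v \<circ> tree_swap) = True"
  "odd_perm (Suc n) (tree_pair u v) \<longleftrightarrow> odd_perm n u \<noteq> odd_perm n v"
  "odd_perm (Suc n) (tree_pair u v \<circ> tree_swap) \<longleftrightarrow> odd_perm n u \<noteq> odd_perm n v"
  by auto

lemma odd_perm_id [simp]: "\<not> odd_perm n id"
  by (induction n) (simp_all add: id_def)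

text \<open>On words of length \<open>Suc n\<close> the swap is a product of 2^n disjoint
  transpositions, an even number unless n = 0.\<close>

lemma odd_perm_swap: "odd_perm n tree_swap \<longleftrightarrow> n = 0"
  by (cases n) simp_all

lemma odd_perm_comp:
  "f \<in> tree_aut \<Longrightarrow> g \<in> tree_aut \<Longrightarrow> odd_perm n (f \<circ> g) \<longleftrightarrow> odd_perm n f \<noteq> odd_perm n g"
proof (induction n arbitrary: f g)
  case 0
  from 0(1) show "odd_perm 0 (f \<circ> g) \<longleftrightarrow> odd_perm 0 f \<noteq> odd_perm 0 g"
    by (rule tree_aut_cases; use 0(2) in \<open>rule tree_aut_cases\<close>)
       (simp_all add: tree_pair_comp tree_pair_swap_comp del: odd_perm.simps)
next
  case (Suc n)
  from Suc.prems(1) show "odd_perm (Suc n) (f \<circ> g) \<longleftrightarrow> odd_perm (Suc n) f \<noteq> odd_perm (Suc n) g"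
    by (rule tree_aut_cases; use Suc.prems(2) in \<open>rule tree_aut_cases\<close>)
       (auto simp: tree_pair_comp tree_pair_swap_comp Suc.IH simp del: odd_perm.simps)
qed

lemma odd_perm_inv: "f \<in> tree_aut \<Longrightarrow> odd_perm n (inv\<^bsub>AutT\<^esub> f) = odd_perm n f"
  using odd_perm_comp[of f "inv\<^bsub>AutT\<^esub> f" n] by (simp add: AutT_inv_comp tree_aut_AutT_inv)

lemma odd_perm_agree: "agree (Suc n) f g \<Longrightarrow> odd_perm n f = odd_perm n g"
proof (induction n arbitrary: f g)
  case (Suc n)
  have "agree (Suc n) (\<lambda>w. tl (f (x # w))) (\<lambda>w. tl (g (x # w)))" for x
    using Suc.prems by (simp add: agree_def)
  from Suc.IH[OF this] show ?case by simp
qed (simp add: agree_def)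


subsection \<open>The automorphisms with even sections\<close>

text \<open>The parity condition says that \<open>f\<close> is even on level m + 2, expressed
  through its two sections on level m + 1. For G(r) the index is m = r - 1, so the sections are
  compared on level r and \<open>f\<close> is even on level r + 1.\<close>

definition even_lift :: "nat \<Rightarrow> (bool list \<Rightarrow> bool list) set \<Rightarrow> (bool list \<Rightarrow> bool list) set" where
  "even_lift m S = {f. \<exists>u\<in>S. \<exists>v\<in>S. odd_perm m u = odd_perm m v \<and>
     (f = tree_pair u v \<or> f = tree_pair u v \<circ> tree_swap)}"

text \<open>The greatest fixed point of \<open>even_lift m\<close> among sets of automorphisms:
  those whose sections at all vertices are even on level m + 2. This form replaces sections at
  arbitrary vertices by coinduction on the two sections at the root.\<close>

definition even_group :: "nat \<Rightarrow> (bool list \<Rightarrow> bool list) set" where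
  "even_group m = \<Union>{S. S \<subseteq> tree_aut \<and> S \<subseteq> even_lift m S}"

lemma even_lift_mono: "S \<subseteq> Y \<Longrightarrow> even_lift m S \<subseteq> even_lift m Y"
  unfolding even_lift_def by blast

lemma even_lift_tree_aut: "S \<subseteq> tree_aut \<Longrightarrow> even_lift m S \<subseteq> tree_aut"
  by (auto simp: even_lift_def intro!: tree_aut_pair tree_aut_comp tree_aut_swap)

lemma even_group_coinduct: "S \<subseteq> tree_aut \<Longrightarrow> S \<subseteq> even_lift m S \<Longrightarrow> S \<subseteq> even_group m"
  unfolding even_group_def by blast

lemma even_group_tree_aut: "even_group m \<subseteq> tree_aut"
  unfolding even_group_def by blast

lemma even_group_eq: "even_lift m (even_group m) = even_group m"
proof
  show *: "even_group m \<subseteq> even_lift m (even_group m)"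
  proof
    fix f assume "f \<in> even_group m"
    then obtain S where S: "S \<subseteq> tree_aut" "S \<subseteq> even_lift m S" "f \<in> S"
      by (auto simp: even_group_def)
    then have "S \<subseteq> even_group m" by (intro even_group_coinduct)
    with S show "f \<in> even_lift m (even_group m)" using even_lift_mono by blast
  qed
  show "even_lift m (even_group m) \<subseteq> even_group m"
    by (intro even_group_coinduct even_lift_tree_aut even_group_tree_aut even_lift_mono *)
qed

text \<open>The two sections have equal parity on level n + 1: by definition of the lift if n = m,
  and because both are even there, by induction, if n > m.\<close>

lemma even_group_not_odd: "f \<in> even_group m \<Longrightarrow> m < n \<Longrightarrow> \<not> odd_perm n f"
proof (induction n arbitrary: f)
  case (Suc n)
  from Suc.prems(1) obtain u v where uv: "u \<in> even_group m" "v \<in> even_group m"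
      "odd_perm m u = odd_perm m v" "f = tree_pair u v \<or> f = tree_pair u v \<circ> tree_swap"
    using even_group_eq unfolding even_lift_def by blast
  then have "odd_perm n u = odd_perm n v"
    using Suc.IH Suc.prems(2) by (cases "n = m") auto
  with uv(4) show "\<not> odd_perm (Suc n) f" by (auto simp del: odd_perm.simps)
qed simp

text \<open>Parity is a homomorphism, and a swap only exchanges the two sections, so equality of
  their parities survives products and inverses.\<close>

lemma even_lift_subgroup:
  assumes "subgroup S AutT" shows "subgroup (even_lift m S) AutT"
proof (rule AutT.subgroupI)
  interpret S: subgroup S AutT by fact
  have S: "S \<subseteq> tree_aut" "\<And>u v. u \<in> S \<Longrightarrow> v \<in> S \<Longrightarrow> u \<circ> v \<in> S"
    "\<And>u. u \<in> S \<Longrightarrow> inv\<^bsub>AutT\<^esub> u \<in> S"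
    using S.subset S.m_closed by auto
  show "even_lift m S \<subseteq> carrier AutT"
    using even_lift_tree_aut[OF S(1)] by simp
  show "even_lift m S \<noteq> {}"
    using S.one_closed unfolding even_lift_def by auto
next
  interpret S: subgroup S AutT by fact
  have S: "u \<in> tree_aut" "inv\<^bsub>AutT\<^esub> u \<in> S" if "u \<in> S" for u
    using that S.subset by auto
  fix f assume "f \<in> even_lift m S"
  then show "inv\<^bsub>AutT\<^esub> f \<in> even_lift m S"
    unfolding even_lift_def using S
    by (auto simp: AutT_inv_pair odd_perm_inv) (use S odd_perm_inv in metis)+
next
  interpret S: subgroup S AutT by fact
  have S: "u \<in> tree_aut" if "u \<in> S" for u
    using that S.subset by auto
  have comp: "u \<circ> v \<in> S" if "u \<in> S" "v \<in> S" for u v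
    using S.m_closed that by simp
  fix f g assume "f \<in> even_lift m S" and "g \<in> even_lift m S"
  then obtain u v u' v' where uv: "u \<in> S" "v \<in> S" "odd_perm m u = odd_perm m v"
      "f = tree_pair u v \<or> f = tree_pair u v \<circ> tree_swap"
    and uv': "u' \<in> S" "v' \<in> S" "odd_perm m u' = odd_perm m v'"
      "g = tree_pair u' v' \<or> g = tree_pair u' v' \<circ> tree_swap"
    unfolding even_lift_def by blast
  have odd: "odd_perm m (u \<circ> u') = odd_perm m (v \<circ> v')" "odd_perm m (u \<circ> v') = odd_perm m (v \<circ> u')"
    using uv uv' by (simp_all add: odd_perm_comp S)
  have "f \<circ> g \<in> {tree_pair (u \<circ> u') (v \<circ> v'), tree_pair (u \<circ> v') (v \<circ> u'),
      tree_pair (u \<circ> u') (v \<circ> v') \<circ> tree_swap, tree_pair (u \<circ> v') (v \<circ> u') \<circ> tree_swap}"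
    using uv(4) uv'(4) by (auto simp: tree_pair_comp tree_pair_swap_comp)
  then show "f \<otimes>\<^bsub>AutT\<^esub> g \<in> even_lift m S"
    unfolding even_lift_def AutT_simps using odd comp uv(1,2) uv'(1,2) by blast
qed

text \<open>Coinduction on the generated subgroup \<open>?S\<close>: its lift is a subgroup
  containing the generators, hence contains \<open>?S\<close>. So generating adds nothing
  new.\<close>

lemma even_group_subgroup: "subgroup (even_group m) AutT"
proof -
  let ?S = "generate AutT (even_group m)"
  have carr: "even_group m \<subseteq> carrier AutT" using even_group_tree_aut by simp
  then have S: "subgroup ?S AutT" by (rule AutT.generate_is_subgroup)
  have sub: "even_group m \<subseteq> ?S" by (blast intro: generate.incl)
  then have "even_group m \<subseteq> even_lift m ?S" using even_group_eq even_lift_mono by blast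
  then have "?S \<subseteq> even_lift m ?S"
    using AutT.generate_subgroup_incl even_lift_subgroup[OF S] by blast
  moreover have "?S \<subseteq> tree_aut" using AutT.generate_incl[OF carr] by simp
  ultimately have "?S \<subseteq> even_group m" by (intro even_group_coinduct)
  with sub S show ?thesis by (metis subset_antisym)
qed

text \<open>Coinduction on the set of all limits: sections of approximations approximate the
  sections.\<close>

lemma even_group_limit:
  assumes f: "f \<in> tree_aut" "\<And>n. \<exists>g\<in>even_group m. agree n f g"
  shows "f \<in> even_group m"
proof -
  let ?S = "{f \<in> tree_aut. \<forall>n. \<exists>g\<in>even_group m. agree n f g}"
  have "?S \<subseteq> even_lift m ?S"
  proof safe
    fix f assume f: "f \<in> tree_aut" and lim: "\<forall>n. \<exists>g\<in>even_group m. agree n f g"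
    obtain u v where uv: "u \<in> tree_aut" "v \<in> tree_aut" "f = tree_pair u v \<or> f = tree_pair u v \<circ> tree_swap"
      using tree_aut_decompose[OF f] by blast
    have ex: "\<exists>u'\<in>even_group m. \<exists>v'\<in>even_group m.
        odd_perm m u' = odd_perm m v' \<and> agree n u u' \<and> agree n v v'" for n
    proof -
      obtain g where g: "g \<in> even_group m" "agree (Suc n) f g" using lim by blast
      obtain u' v' where uv': "u' \<in> even_group m" "v' \<in> even_group m" "odd_perm m u' = odd_perm m v'"
          "g = tree_pair u' v' \<or> g = tree_pair u' v' \<circ> tree_swap"
        using g(1) even_group_eq unfolding even_lift_def by blast
      \<comment> \<open>Parity on level 1 records whether the two subtrees are exchanged, so
        \<open>f\<close> and \<open>g\<close> have the same shape.\<close>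
      have "odd_perm 0 f = odd_perm 0 g"
        using g(2) by (intro odd_perm_agree) (rule agree_mono, auto)
      with uv(3) uv'(4) consider "f = tree_pair u v" "g = tree_pair u' v'"
        | "f = tree_pair u v \<circ> tree_swap" "g = tree_pair u' v' \<circ> tree_swap"
        by (auto simp del: odd_perm.simps)
      then have "agree (Suc n) (tree_pair u v) (tree_pair u' v')"
      proof cases
        case 2
        then have "agree (Suc n) (tree_pair u v \<circ> tree_swap \<circ> tree_swap)
            (tree_pair u' v' \<circ> tree_swap \<circ> tree_swap)"
          using g(2) by (simp only: agree_comp[OF _ agree_refl tree_aut_swap])
        then show ?thesis by (simp only: tree_swap_swap')
      qed (use g in simp)
      from agree_pairD[OF this] uv' show ?thesis by blast
    qed
    have "u \<in> ?S" "v \<in> ?S" using ex uv by blast+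
    \<comment> \<open>An approximation up to level m + 1 already has the parities of
      \<open>u\<close> and \<open>v\<close> on that level.\<close>
    moreover have "odd_perm m u = odd_perm m v"
      using ex[of "Suc m"] odd_perm_agree by metis
    ultimately show "f \<in> even_lift m ?S" unfolding even_lift_def using uv(3) by blast
  qed
  then have "?S \<subseteq> even_group m" by (intro even_group_coinduct) auto
  with f show ?thesis by blast
qed

section \<open>Topological closure as approximation on finite levels\<close>

lemma AutT_closure_of_iff:
  assumes "S \<subseteq> tree_aut"
  shows "f \<in> AutT_topology closure_of S \<longleftrightarrow> f \<in> tree_aut \<and> (\<forall>n. \<exists>g\<in>S. agree n f g)"
proof safe
  let ?P = "product_topology (\<lambda>_. discrete_topology UNIV) UNIV :: (bool list \<Rightarrow> bool list) topology"
  assume f: "f \<in> AutT_topology closure_of S"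
  then show "f \<in> tree_aut" by (auto simp: in_closure_of AutT_topology_def)
  fix n
  let ?U = "Pi\<^sub>E UNIV (\<lambda>w. if length w \<le> n then {f w} else UNIV)"
  have "finite {w :: bool list. length w \<le> n}"
    using finite_lists_length_le[of "UNIV :: bool set" n] by simp
  then have "finite {w :: bool list. (if length w \<le> n then {f w} else UNIV) \<noteq> (UNIV :: bool list set)}"
    by (rule rev_finite_subset) auto
  then have "openin ?P ?U" by (auto intro!: product_topology_basis)
  then have "openin AutT_topology (?U \<inter> tree_aut)"
    by (auto simp: AutT_topology_def openin_subtopology)
  moreover have "f \<in> ?U \<inter> tree_aut" using \<open>f \<in> tree_aut\<close> by auto
  ultimately obtain g where "g \<in> S" "g \<in> ?U"
    using f unfolding in_closure_of by blast
  moreover from \<open>g \<in> ?U\<close> have "g w = f w" if "length w \<le> n" for w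
    using PiE_mem[OF \<open>g \<in> ?U\<close>, of w] that by simp
  ultimately show "\<exists>g\<in>S. agree n f g" by (metis agree_def)
next
  assume f: "f \<in> tree_aut" and lim: "\<forall>n. \<exists>g\<in>S. agree n f g"
  have "\<exists>g\<in>S. g \<in> T" if T: "f \<in> T" "openin AutT_topology T" for T
  proof -
    obtain T' where T': "openin (product_topology (\<lambda>_. discrete_topology UNIV) UNIV) T'"
        "T = T' \<inter> tree_aut"
      using T(2) by (auto simp: AutT_topology_def openin_subtopology)
    then obtain U where U: "finite {w. U w \<noteq> (UNIV :: bool list set)}" "f \<in> Pi\<^sub>E UNIV U" "Pi\<^sub>E UNIV U \<subseteq> T'"
      using T(1) by (force simp: openin_product_topology_alt)
    \<comment> \<open>Only finitely many words are constrained by \<open>U\<close>; \<open>n\<close>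
      bounds their lengths, so agreement with \<open>f\<close> up to level \<open>n\<close> forces
      membership.\<close>
    obtain n where n: "\<forall>w\<in>{w. U w \<noteq> UNIV}. length w \<le> n"
      using U(1) by (metis finite_imageI finite_nat_set_iff_bounded_le imageI)
    obtain g where g: "g \<in> S" "agree n f g" using lim by blast
    have "g w \<in> U w" for w
    proof (cases "U w = UNIV")
      case False
      then have "g w = f w" using n g by (auto simp: agree_def)
      then show ?thesis using U(2) by auto
    qed simp
    then have "g \<in> T" using U(3) T' g assms by auto
    with g show ?thesis by blast
  qed
  then show "f \<in> AutT_topology closure_of S"
    using f by (auto simp: in_closure_of AutT_topology_def)
qed


subsection \<open>The group generated by the recursion\<close>

text \<open>The closure is computed for an arbitrary solution of the relations, without reference to
  the description by \<open>THE\<close>; \<open>grp_G_eq\<close> instantiates it.\<close>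

locale rec_gens =
  fixes r :: nat and a b :: "nat \<Rightarrow> bool list \<Rightarrow> bool list"
  assumes r_pos: "1 \<le> r"
    and a_aut: "1 \<le> i \<Longrightarrow> a i \<in> tree_aut"
    and b_aut: "1 \<le> j \<Longrightarrow> j \<le> r \<Longrightarrow> b j \<in> tree_aut"
    and rel: "recursion_relations r a b"
begin

abbreviation \<Gamma> :: "(bool list \<Rightarrow> bool list) set" where
  "\<Gamma> \<equiv> generate AutT (a ` {1..} \<union> b ` {1..r})"

lemmas a_1 = recursion_relationsD(1)[OF rel]
  and a_Suc_r = recursion_relationsD(2)[OF rel]
  and a_pair = recursion_relationsD(3)[OF rel]
  and b_1 = recursion_relationsD(4)[OF rel]
  and b_pair = recursion_relationsD(5)[OF rel]

lemma gens_carrier: "a ` {1..} \<union> b ` {1..r} \<subseteq> carrier AutT"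
  using a_aut b_aut by auto

lemma \<Gamma>_subgroup: "subgroup \<Gamma> AutT"
  using gens_carrier by (rule AutT.generate_is_subgroup)

lemma \<Gamma>_a: "1 \<le> i \<Longrightarrow> a i \<in> \<Gamma>" and \<Gamma>_b: "1 \<le> j \<Longrightarrow> j \<le> r \<Longrightarrow> b j \<in> \<Gamma>"
  by (auto intro: generate.incl)

lemma \<Gamma>_comp: "f \<in> \<Gamma> \<Longrightarrow> g \<in> \<Gamma> \<Longrightarrow> f \<circ> g \<in> \<Gamma>"
  using generate.eng[of f AutT _ g] by simp

lemma \<Gamma>_inv: "f \<in> \<Gamma> \<Longrightarrow> inv\<^bsub>AutT\<^esub> f \<in> \<Gamma>"
  by (rule subgroup.m_inv_closed[OF \<Gamma>_subgroup])

lemma \<Gamma>_id: "id \<in> \<Gamma>"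
  using generate.one[of AutT] by simp

lemma \<Gamma>_tree_aut: "f \<in> \<Gamma> \<Longrightarrow> f \<in> tree_aut"
  using AutT.generate_incl[OF gens_carrier] by auto

lemma b_r_aut: "b r \<in> tree_aut"
  using b_aut r_pos by simp

text \<open>The square of \<open>b 1\<close> is trivial whatever the order of \<open>b r\<close>,
  since its sections are products of \<open>b r\<close> with its inverse. Each later generator is a
  pair of a conjugate of its predecessor and the identity.\<close>

lemma b_involution: "1 \<le> j \<Longrightarrow> j \<le> r \<Longrightarrow> b j \<circ> b j = id"
proof (induction j rule: dec_induct)
  case base
  show "b 1 \<circ> b 1 = id"
    using b_r_aut b_1 by (simp add: tree_pair_swap_comp AutT_inv_comp tree_pair_id)
next
  case (step j)
  have IH: "b j \<circ> b j = id" using step.IH step.prems by (metis Suc_leD)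
  let ?c = "b r" and ?d = "inv\<^bsub>AutT\<^esub> (b r)"
  have "(?c \<circ> b j \<circ> ?d) \<circ> (?c \<circ> b j \<circ> ?d) = ?c \<circ> b j \<circ> (?d \<circ> ?c) \<circ> b j \<circ> ?d"
    by (simp only: comp_assoc)
  also have "\<dots> = ?c \<circ> (b j \<circ> b j) \<circ> ?d"
    using b_r_aut by (simp only: AutT_inv_comp comp_id comp_assoc)
  also have "\<dots> = id"
    using IH b_r_aut by (simp add: AutT_inv_comp)
  finally show "b (Suc j) \<circ> b (Suc j) = id"
    using step b_pair[of "Suc j"] by (simp add: tree_pair_comp tree_pair_id)
qed

lemma b_r_inv: "inv\<^bsub>AutT\<^esub> (b r) = b r"
  using b_r_aut b_involution[of r] r_pos by (intro AutT.inv_equality) auto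

text \<open>Passing to a pair with trivial second section shifts level and index by one. The
  exceptional generators are even on levels 2 to r: the sections of \<open>a (r + 1)\<close> are
  even below level r, and those of \<open>b 1\<close> are equal because \<open>b r\<close> is an
  involution.\<close>

lemma odd_perm_gens:
  "m < r \<Longrightarrow> (\<forall>i\<ge>1. odd_perm m (a i) \<longleftrightarrow> i = Suc m) \<and> (\<forall>j. 1 \<le> j \<and> j \<le> r \<longrightarrow> (odd_perm m (b j) \<longleftrightarrow> j = Suc m))"
proof (induction m)
  case 0
  have "odd_perm 0 (a i) \<longleftrightarrow> i = Suc 0" if "1 \<le> i" for i
    using that a_1 a_Suc_r a_pair[of i]
    by (cases "i = 1"; cases "i = r + 1") (auto simp del: odd_perm.simps simp: odd_perm_swap)
  moreover have "odd_perm 0 (b j) \<longleftrightarrow> j = Suc 0" if "1 \<le> j" "j \<le> r" for j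
    using that b_1 b_pair[of j] by (cases "j = 1") (auto simp del: odd_perm.simps)
  ultimately show ?case by blast
next
  case (Suc m)
  then have A: "\<And>i. 1 \<le> i \<Longrightarrow> odd_perm m (a i) \<longleftrightarrow> i = Suc m"
    and B: "\<And>j. 1 \<le> j \<Longrightarrow> j \<le> r \<Longrightarrow> odd_perm m (b j) \<longleftrightarrow> j = Suc m" by auto
  have "odd_perm (Suc m) (a i) \<longleftrightarrow> i = Suc (Suc m)" if i: "1 \<le> i" for i
  proof -
    consider "i = 1" | "i = r + 1" | "1 < i" "i \<noteq> r + 1" using i by linarith
    then show ?thesis
    proof cases
      case 1
      then show ?thesis using a_1 by (simp add: odd_perm_swap del: odd_perm.simps)
    next
      case 2
      then show ?thesis
        using a_Suc_r A[of r] B[of r] r_pos Suc.prems by (simp del: odd_perm.simps)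
    next
      case 3
      then show ?thesis using a_pair[of i] A[of "i - 1"] by (auto simp del: odd_perm.simps)
    qed
  qed
  moreover have "odd_perm (Suc m) (b j) \<longleftrightarrow> j = Suc (Suc m)" if j: "1 \<le> j" "j \<le> r" for j
  proof (cases "j = 1")
    case True
    then show ?thesis using b_1 b_r_inv by (simp del: odd_perm.simps)
  next
    case False
    with j have "b j = tree_pair (b r \<circ> b (j - 1) \<circ> inv\<^bsub>AutT\<^esub> (b r)) id" "b (j - 1) \<in> tree_aut"
      using b_pair[of j] b_aut[of "j - 1"] by auto
    then show ?thesis
      using j False B[of "j - 1"] b_r_aut
      by (auto simp: odd_perm_comp odd_perm_inv tree_aut_comp tree_aut_AutT_inv simp del: odd_perm.simps)
  qed
  ultimately show ?case by blast
qed

lemma odd_perm_a: "1 \<le> i \<Longrightarrow> odd_perm (r - 1) (a i) \<longleftrightarrow> i = r"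
  and odd_perm_b: "1 \<le> j \<Longrightarrow> j \<le> r \<Longrightarrow> odd_perm (r - 1) (b j) \<longleftrightarrow> j = r"
  using odd_perm_gens[of "r - 1"] r_pos by auto

text \<open>By coinduction it suffices that the generators lie in the lift. Both sections of
  \<open>a (r + 1)\<close> are odd on level r, those of \<open>b 1\<close> coincide, and in all
  other cases the index of the first section differs from r, so both sections are even
  there.\<close>

lemma \<Gamma>_subset_even_group: "\<Gamma> \<subseteq> even_group (r - 1)"
proof (rule even_group_coinduct)
  show "\<Gamma> \<subseteq> tree_aut" using \<Gamma>_tree_aut by blast
  have pairI: "tree_pair u v \<in> even_lift (r - 1) \<Gamma>"
      "tree_pair u v \<circ> tree_swap \<in> even_lift (r - 1) \<Gamma>"
    if "u \<in> \<Gamma>" "v \<in> \<Gamma>" "odd_perm (r - 1) u = odd_perm (r - 1) v" for u v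
    using that unfolding even_lift_def by blast+
  have "a i \<in> even_lift (r - 1) \<Gamma>" if i: "1 \<le> i" for i
  proof -
    consider "i = 1" | "i = r + 1" | "1 < i" "i \<noteq> r + 1" using i by linarith
    then show ?thesis
    proof cases
      case 1
      then have "a i = tree_pair id id \<circ> tree_swap" using a_1 by (simp add: tree_pair_id)
      then show ?thesis using pairI(2)[of id id] \<Gamma>_id by simp
    next
      case 2
      then show ?thesis
        using pairI(1)[of "a r" "b r"] a_Suc_r \<Gamma>_a \<Gamma>_b odd_perm_a[of r] odd_perm_b[of r] r_pos
        by simp
    next
      case 3
      then have "\<not> odd_perm (r - 1) (a (i - 1))" using odd_perm_a[of "i - 1"] by auto
      then show ?thesis
        using 3 pairI(1)[of "a (i - 1)" id] a_pair[of i] \<Gamma>_a \<Gamma>_id by simp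
    qed
  qed
  moreover have "b j \<in> even_lift (r - 1) \<Gamma>" if j: "1 \<le> j" "j \<le> r" for j
  proof (cases "j = 1")
    case True
    then show ?thesis
      using pairI(2)[of "b r" "b r"] b_1 b_r_inv \<Gamma>_b r_pos by simp
  next
    case False
    let ?c = "b r \<circ> b (j - 1) \<circ> inv\<^bsub>AutT\<^esub> (b r)"
    have "b (j - 1) \<in> tree_aut" "\<not> odd_perm (r - 1) (b (j - 1))"
      using j False b_aut odd_perm_b[of "j - 1"] by auto
    then have "\<not> odd_perm (r - 1) ?c"
      using b_r_aut by (simp add: odd_perm_comp odd_perm_inv tree_aut_comp tree_aut_AutT_inv)
    moreover have "?c \<in> \<Gamma>" using j False by (intro \<Gamma>_comp \<Gamma>_inv \<Gamma>_b) auto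
    ultimately show ?thesis
      using pairI(1)[of ?c id] b_pair[of j] j False \<Gamma>_id by simp
  qed
  ultimately have "a ` {1..} \<union> b ` {1..r} \<subseteq> even_lift (r - 1) \<Gamma>" by auto
  then show "\<Gamma> \<subseteq> even_lift (r - 1) \<Gamma>"
    by (rule AutT.generate_subgroup_incl) (rule even_lift_subgroup[OF \<Gamma>_subgroup])
qed

section \<open>Pairs in the generated group\<close>

lemma \<Gamma>_swap: "tree_swap \<in> \<Gamma>"
  using \<Gamma>_a[of 1] a_1 by simp

lemma \<Gamma>_b_r_b_r: "tree_pair (b r) (b r) \<in> \<Gamma>"
proof -
  have "b 1 \<circ> tree_swap = tree_pair (b r) (b r)"
    by (simp only: b_1 b_r_inv tree_swap_swap')
  then show ?thesis using \<Gamma>_comp[OF \<Gamma>_b[of 1] \<Gamma>_swap] r_pos by simp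
qed

lemma \<Gamma>_companion:
  "u \<in> \<Gamma> \<Longrightarrow> tree_pair u (if odd_perm (r - 1) u then b r else id) \<in> \<Gamma>"
proof -
  define c where "c u = (if odd_perm (r - 1) u then b r else id)" for u
  have c_mult: "c (u \<circ> v) = c u \<circ> c v" if "u \<in> tree_aut" "v \<in> tree_aut" for u v
    using that b_involution[of r] r_pos by (auto simp: c_def odd_perm_comp)
  have c_aut: "c u \<in> tree_aut" for u by (simp add: c_def b_r_aut tree_aut_id)
  have c_inv: "c (inv\<^bsub>AutT\<^esub> u) = inv\<^bsub>AutT\<^esub> (c u)" if "u \<in> tree_aut" for u
    using that AutT.inv_one by (simp add: c_def odd_perm_inv b_r_inv)
  \<comment> \<open>Since \<open>c\<close> is a homomorphism, the condition cuts out a subgroup and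
    need only be checked on generators.\<close>
  have "subgroup {u \<in> tree_aut. tree_pair u (c u) \<in> \<Gamma>} AutT"
  proof (rule AutT.subgroupI, goal_cases)
    case 2
    have "id \<in> {u \<in> tree_aut. tree_pair u (c u) \<in> \<Gamma>}"
      using \<Gamma>_id by (simp add: c_def tree_aut_id tree_pair_id)
    then show ?case by blast
  next
    case (3 u)
    then have "inv\<^bsub>AutT\<^esub> (tree_pair u (c u)) \<in> \<Gamma>" by (intro \<Gamma>_inv) simp
    with 3 show ?case by (simp add: AutT_inv_pair c_aut c_inv tree_aut_AutT_inv)
  next
    case (4 u v)
    then have "tree_pair u (c u) \<circ> tree_pair v (c v) \<in> \<Gamma>" by (intro \<Gamma>_comp) simp_all
    with 4 show ?case by (simp add: tree_pair_comp c_mult tree_aut_comp)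
  qed auto
  moreover have "tree_pair (a i) (c (a i)) \<in> \<Gamma>" if "1 \<le> i" for i
    using that \<Gamma>_a[of "Suc i"] a_Suc_r a_pair[of "Suc i"] odd_perm_a[of i]
    by (cases "i = r") (auto simp: c_def)
  moreover have "tree_pair (b j) (c (b j)) \<in> \<Gamma>" if j: "1 \<le> j" "j \<le> r" for j
  proof (cases "j = r")
    case True
    then show ?thesis using \<Gamma>_b_r_b_r odd_perm_b[of r] r_pos by (simp add: c_def)
  next
    case False
    \<comment> \<open>Conjugation by \<open>?p\<close> undoes the conjugation by \<open>b r\<close>
      in the recursion for \<open>b (Suc j)\<close>.\<close>
    let ?p = "tree_pair (b r) (b r)"
    have "b r \<circ> (b r \<circ> b j \<circ> b r) \<circ> b r = (b r \<circ> b r) \<circ> b j \<circ> (b r \<circ> b r)"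
      by (simp only: comp_assoc)
    also have "\<dots> = b j" using b_involution[of r] r_pos by simp
    finally have "?p \<circ> b (Suc j) \<circ> ?p = tree_pair (b j) id"
      using j False b_pair[of "Suc j"] b_involution[of r] r_pos by (simp add: b_r_inv tree_pair_comp)
    moreover have "?p \<circ> b (Suc j) \<circ> ?p \<in> \<Gamma>"
      using j False by (intro \<Gamma>_comp \<Gamma>_b_r_b_r \<Gamma>_b) auto
    ultimately show ?thesis using j False odd_perm_b[of j] by (simp add: c_def)
  qed
  ultimately have "\<Gamma> \<subseteq> {u \<in> tree_aut. tree_pair u (c u) \<in> \<Gamma>}"
    using a_aut b_aut by (intro AutT.generate_subgroup_incl) auto
  then show "u \<in> \<Gamma> \<Longrightarrow> tree_pair u (if odd_perm (r - 1) u then b r else id) \<in> \<Gamma>"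
    unfolding c_def by blast
qed

text \<open>Let \<open>c\<close> be the companion of \<open>u\<close>. Then (u, v) = (u, c)(1, cv),
  because c is an involution or trivial. As cv is even on level r, its companion is trivial, and the
  second factor is a swap conjugate of (cv, 1).\<close>

lemma \<Gamma>_pair:
  assumes u: "u \<in> \<Gamma>" and v: "v \<in> \<Gamma>" and eq: "odd_perm (r - 1) u = odd_perm (r - 1) v"
  shows "tree_pair u v \<in> \<Gamma>"
proof -
  define c where "c = (if odd_perm (r - 1) u then b r else id)"
  have c: "c \<in> \<Gamma>" "c \<circ> c = id" "odd_perm (r - 1) c = odd_perm (r - 1) u"
    using b_involution[of r] r_pos odd_perm_b[of r] \<Gamma>_id \<Gamma>_b by (auto simp: c_def)
  have "\<not> odd_perm (r - 1) (c \<circ> v)"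
    using c eq v by (simp add: odd_perm_comp \<Gamma>_tree_aut)
  with \<Gamma>_companion[OF \<Gamma>_comp[OF c(1) v]] have "tree_pair (c \<circ> v) id \<in> \<Gamma>" by simp
  then have "tree_swap \<circ> tree_pair (c \<circ> v) id \<circ> tree_swap \<in> \<Gamma>"
    by (intro \<Gamma>_comp \<Gamma>_swap)
  then have "tree_pair id (c \<circ> v) \<in> \<Gamma>" by (simp only: tree_swap_pair tree_swap_swap')
  with \<Gamma>_companion[OF u] have "tree_pair u c \<circ> tree_pair id (c \<circ> v) \<in> \<Gamma>"
    by (intro \<Gamma>_comp) (simp_all add: c_def)
  then show ?thesis using c(2) by (simp add: tree_pair_comp comp_assoc[symmetric])
qed

section \<open>Density of the generated group\<close>

lemma agree_a_id: "1 \<le> i \<Longrightarrow> i \<le> r \<Longrightarrow> agree (i - 1) (a i) id"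
proof (induction i rule: dec_induct)
  case base
  show "agree (1 - 1) (a 1) id" using agree_0[OF tree_aut_swap tree_aut_id] a_1 by simp
next
  case (step i)
  have "agree (i - 1) (a i) id" using step.IH step.prems by (metis Suc_leD)
  then have "agree (Suc (i - 1)) (tree_pair (a i) id) (tree_pair id id)"
    by (intro agree_pair agree_refl)
  then show "agree (Suc i - 1) (a (Suc i)) id"
    using step a_pair[of "Suc i"] by (simp add: tree_pair_id)
qed

text \<open>The two sections are approximated by induction; before \<open>\<Gamma>_pair\<close> can
  combine the approximations, their parities on level r must be made equal.\<close>

lemma \<Gamma>_dense: "f \<in> even_group (r - 1) \<Longrightarrow> \<exists>g\<in>\<Gamma>. agree n f g"
proof (induction n arbitrary: f)
  case 0
  then show ?case using \<Gamma>_id even_group_tree_aut agree_0 tree_aut_id by blast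
next
  case (Suc n)
  then obtain u v where uv: "u \<in> even_group (r - 1)" "v \<in> even_group (r - 1)"
      "odd_perm (r - 1) u = odd_perm (r - 1) v" "f = tree_pair u v \<or> f = tree_pair u v \<circ> tree_swap"
    using even_group_eq unfolding even_lift_def by blast
  obtain u' v0 where u': "u' \<in> \<Gamma>" "agree n u u'" and v0: "v0 \<in> \<Gamma>" "agree n v v0"
    using Suc.IH uv by blast
  have "\<exists>v'\<in>\<Gamma>. agree n v v' \<and> odd_perm (r - 1) u' = odd_perm (r - 1) v'"
  \<comment> \<open>For n < r, agreement up to level n leaves the parity on level r open.
    Multiplying \<open>v0\<close> by \<open>a r\<close> corrects it, since \<open>a r\<close> is odd
    on level r and trivial on all levels below r.\<close>
  proof (cases "odd_perm (r - 1) u' = odd_perm (r - 1) v0")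
    case False
    have "n < r"
    proof (rule ccontr)
      assume "\<not> n < r"
      then have "Suc (r - 1) \<le> n" using r_pos by simp
      then have "odd_perm (r - 1) u = odd_perm (r - 1) u'" "odd_perm (r - 1) v = odd_perm (r - 1) v0"
        using u' v0 by (auto intro!: odd_perm_agree elim: agree_mono)
      with False uv(3) show False by simp
    qed
    moreover have "agree (r - 1) (a r) id" using agree_a_id[of r] r_pos by simp
    ultimately have "agree n id (a r)" by (simp add: agree_def)
    then have "agree n (v \<circ> id) (v0 \<circ> a r)"
      using v0 by (intro agree_comp tree_aut_id)
    moreover have "odd_perm (r - 1) u' = odd_perm (r - 1) (v0 \<circ> a r)"
      using False v0 \<Gamma>_a[of r] r_pos odd_perm_a[of r] by (auto simp: odd_perm_comp \<Gamma>_tree_aut)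
    ultimately show ?thesis using \<Gamma>_comp[OF v0(1) \<Gamma>_a[of r]] r_pos by auto
  qed (use v0 in blast)
  then obtain v' where v': "v' \<in> \<Gamma>" "agree n v v'" "odd_perm (r - 1) u' = odd_perm (r - 1) v'"
    by blast
  have "tree_pair u' v' \<in> \<Gamma>" using u' v' by (intro \<Gamma>_pair)
  moreover have "agree (Suc n) (tree_pair u v) (tree_pair u' v')" using u' v' by (intro agree_pair)
  ultimately show ?case
    using uv(4) by (metis \<Gamma>_comp \<Gamma>_swap agree_comp agree_refl tree_aut_swap)
qed

lemma closure_\<Gamma>: "AutT_topology closure_of \<Gamma> = even_group (r - 1)"
proof (rule Set.set_eqI)
  fix f
  have "\<Gamma> \<subseteq> tree_aut" using \<Gamma>_tree_aut by blast
  then have "f \<in> AutT_topology closure_of \<Gamma> \<longleftrightarrow> f \<in> tree_aut \<and> (\<forall>n. \<exists>g\<in>\<Gamma>. agree n f g)"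
    by (rule AutT_closure_of_iff)
  also have "\<dots> \<longleftrightarrow> f \<in> even_group (r - 1)"
    using \<Gamma>_dense[of f] even_group_limit[of f "r - 1"] \<Gamma>_subset_even_group
      even_group_tree_aut[of "r - 1"] by (meson subsetD)
  finally show "f \<in> AutT_topology closure_of \<Gamma> \<longleftrightarrow> f \<in> even_group (r - 1)" .
qed

end

lemma grp_G_eq:
  assumes "1 \<le> r" shows "grp_G r = even_group (r - 1)"
proof -
  interpret rec_gens r "gen_a r" "gen_b r"
    using assms gen_relations[OF assms] by unfold_locales auto
  show ?thesis unfolding grp_G_def by (rule closure_\<Gamma>)
qed


subsection \<open>The normalizer\<close>

lemma even_group_swap: "tree_swap \<in> even_group m"
proof -
  have "id \<in> even_group m"
    using subgroup.one_closed[OF even_group_subgroup] by simp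
  then have "tree_pair id id \<circ> tree_swap \<in> even_lift m (even_group m)"
    unfolding even_lift_def by blast
  then show ?thesis by (simp add: even_group_eq tree_pair_id)
qed

lemma even_group_pairD:
  assumes "tree_pair u v \<in> even_group m \<or> tree_pair u v \<circ> tree_swap \<in> even_group m"
  shows "u \<in> even_group m" "v \<in> even_group m"
proof -
  have inj: "u = u' \<and> v = v'" if "tree_pair u v = tree_pair u' v'" for u' v'
    using agree_pairD[of _ u v u' v'] that agree_all by (metis agree_refl)
  have "tree_pair u v \<in> even_group m"
    using assms subgroup.m_closed[OF even_group_subgroup[of m] _ even_group_swap[of m]]
    by (metis AutT_simps(2) tree_swap_swap')
  then obtain u' v' where uv': "u' \<in> even_group m" "v' \<in> even_group m"
      "tree_pair u v = tree_pair u' v' \<or> tree_pair u v = tree_pair u' v' \<circ> tree_swap"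
    using even_group_eq unfolding even_lift_def by blast
  \<comment> \<open>Parity on level 1 distinguishes the two shapes.\<close>
  moreover have "tree_pair u v \<noteq> tree_pair u' v' \<circ> tree_swap"
    by (metis odd_perm_pair(1,2))
  ultimately show "u \<in> even_group m" "v \<in> even_group m" using inj by auto
qed

text \<open>Coinduction on \<open>?N\<close>: the sections of an element of \<open>?N\<close> lie in
  \<open>?N\<close> again and have equal parity on level n + 1.\<close>

lemma normalizing_even_group_subset:
  assumes "m < n"
  shows "{w \<in> tree_aut. \<forall>g\<in>even_group m. w \<circ> g \<circ> inv\<^bsub>AutT\<^esub> w \<in> even_group m} \<subseteq> even_group n"
    (is "?N \<subseteq> _")
proof (rule even_group_coinduct)
  note aut = tree_aut_AutT_inv tree_aut_comp tree_aut_swap tree_aut_pair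
  show "?N \<subseteq> even_lift n ?N"
  proof
    fix w assume w: "w \<in> ?N"
    then obtain x y where xy: "x \<in> tree_aut" "y \<in> tree_aut"
        "w = tree_pair x y \<or> w = tree_pair x y \<circ> tree_swap"
      using tree_aut_decompose[of w] by blast
    let ?p = "tree_pair x y"
    have inv_p: "inv\<^bsub>AutT\<^esub> ?p = tree_pair (inv\<^bsub>AutT\<^esub> x) (inv\<^bsub>AutT\<^esub> y)"
      using xy by (simp add: AutT_inv_pair)
    have conj_p: "?p \<circ> g \<circ> inv\<^bsub>AutT\<^esub> ?p \<in> even_group m" if g: "g \<in> even_group m" for g
      using xy(3)
    proof
      assume "w = ?p"
      with w g show ?thesis by auto
    next
      assume w_eq: "w = ?p \<circ> tree_swap"
      \<comment> \<open>Conjugating \<open>g\<close> by the swap beforehand compensates the swap in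
        \<open>w\<close> and stays inside the group.\<close>
      have "tree_swap \<circ> g \<circ> tree_swap \<in> even_group m"
        using g even_group_swap subgroup.m_closed[OF even_group_subgroup[of m]] by simp
      with w have "w \<circ> (tree_swap \<circ> g \<circ> tree_swap) \<circ> inv\<^bsub>AutT\<^esub> w \<in> even_group m" by blast
      moreover have "inv\<^bsub>AutT\<^esub> w = tree_swap \<circ> inv\<^bsub>AutT\<^esub> ?p"
        using xy by (simp add: w_eq AutT_inv_pair tree_swap_pair)
      ultimately have "?p \<circ> (tree_swap \<circ> tree_swap) \<circ> g \<circ> (tree_swap \<circ> tree_swap) \<circ> inv\<^bsub>AutT\<^esub> ?p
          \<in> even_group m"
        by (simp only: w_eq comp_assoc)
      then show ?thesis by (simp add: tree_swap_swap)
    qed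
    have "x \<circ> u \<circ> inv\<^bsub>AutT\<^esub> x \<in> even_group m \<and> y \<circ> u \<circ> inv\<^bsub>AutT\<^esub> y \<in> even_group m"
      if u: "u \<in> even_group m" for u
    proof -
      \<comment> \<open>The diagonal satisfies the parity condition for every \<open>u\<close>, so
        both sections of \<open>w\<close> are tested on the whole group.\<close>
      have "tree_pair u u \<in> even_group m"
        using u even_group_eq[of m] unfolding even_lift_def by blast
      from conj_p[OF this] have "tree_pair (x \<circ> u \<circ> inv\<^bsub>AutT\<^esub> x) (y \<circ> u \<circ> inv\<^bsub>AutT\<^esub> y) \<in> even_group m"
        by (simp add: inv_p tree_pair_comp)
      then show ?thesis using even_group_pairD by blast
    qed
    then have "x \<in> ?N" "y \<in> ?N" using xy by auto
    moreover have "odd_perm n x = odd_perm n y"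
    proof -
      have "?p \<circ> tree_swap \<circ> inv\<^bsub>AutT\<^esub> ?p \<in> even_group m"
        by (rule conj_p[OF even_group_swap])
      then have "tree_pair (x \<circ> inv\<^bsub>AutT\<^esub> y) (y \<circ> inv\<^bsub>AutT\<^esub> x) \<circ> tree_swap \<in> even_group m"
        by (simp add: inv_p tree_pair_swap_comp)
      \<comment> \<open>Elements of \<open>even_group m\<close> have sections in
        \<open>even_group m\<close>, and these are even on level n + 1 because m < n.\<close>
      then have "\<not> odd_perm n (x \<circ> inv\<^bsub>AutT\<^esub> y)"
        using even_group_pairD assms even_group_not_odd by blast
      then show ?thesis using xy by (simp add: odd_perm_comp odd_perm_inv tree_aut_AutT_inv)
    qed
    ultimately show "w \<in> even_lift n ?N"
      unfolding even_lift_def using xy(3) by blast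
  qed
qed auto

theorem theorem4p7p1:
  fixes r r' :: nat
  assumes "r' \<ge> 1" and "r > r'"
  shows "grp_G r' \<subseteq> grp_N r' \<and> grp_N r' \<subseteq> grp_G r"
proof
  let ?H = "grp_G r'"
  have H: "?H = even_group (r' - 1)" and G: "grp_G r = even_group (r - 1)"
    using assms by (simp_all add: grp_G_eq)
  have sub: "subgroup ?H AutT" by (simp add: H even_group_subgroup)
  show "?H \<subseteq> grp_N r'"
    unfolding grp_N_def
    using normal_imp_subgroup[OF AutT.subgroup_in_normalizer[OF sub]] subgroup.subset by fastforce
  \<comment> \<open>\<open>normalizer\<close> is the stabilizer of the set \<open>?H\<close> under
    conjugation; the equality of sets is read elementwise here.\<close>
  have "w \<circ> g \<circ> inv\<^bsub>AutT\<^esub> w \<in> ?H" if w: "w \<in> grp_N r'" and g: "g \<in> ?H" for w g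
  proof -
    have "w <#\<^bsub>AutT\<^esub> ?H #>\<^bsub>AutT\<^esub> inv\<^bsub>AutT\<^esub> w = ?H"
      using w subgroup.subset[OF sub] unfolding grp_N_def normalizer_def stabilizer_def by simp
    then show ?thesis using g by (auto simp: l_coset_def r_coset_def)
  qed
  moreover have "grp_N r' \<subseteq> tree_aut"
    by (auto simp: grp_N_def normalizer_def stabilizer_def)
  ultimately have "grp_N r' \<subseteq> {w \<in> tree_aut. \<forall>g\<in>?H. w \<circ> g \<circ> inv\<^bsub>AutT\<^esub> w \<in> ?H}" by blast
  also have "\<dots> \<subseteq> grp_G r"
    unfolding H G using assms by (intro normalizing_even_group_subset) simp
  finally show "grp_N r' \<subseteq> grp_G r" .
qed

end
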